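(* Let $f_1,\dots,f_n:\mathbb{R}^d\to\mathbb{R}$ be such that each $f_i$ is proper, closed, convex, lower bounded, $L_i$-smooth for some $L_i>0$, and $\mu_i$-strongly convex for some $\mu_i>0$, and suppose that the problem of minimizing $f(x)=\sum_{i\in\mathcal{V}} f_i(x)$ over $x\in\mathbb{R}^d$ has a non-empty and bounded set of optimal solutions. Let $W=(w_{ij})\in\mathbb{R}^{n\times n}$ be an averaging matrix associated with the undirected connected graph $\mathcal{G}=(\mathcal{V},\mathcal{E})$. Suppose total asynchrony holds, i.e.: 1) $\mathcal{K}_i$ is an infinite subset of $\mathbb{N}_0$ for each $i\in\mathcal{V}$; 2) $\lim_{k\to+\infty} s_{ij}^k=+\infty$ for any $i\in\mathcal{V}$ and $j\in\mathcal{N}_i$. Then the following hold. (a) If $\{\mathbf{x}^k\}$ is generated by the asynchronous DGD (from an arbitrary initial point $\mathbf{x}^0\in\mathbb{R}^{nd}$) with step-size $$\alpha\in\Big(0,\,2\min_{i\in\mathcal{V}}\frac{w_{ii}}{L_i}\Big),$$ then $\{\mathbf{x}^k\}$ converges to some element of the fixed point set of the synchronous DGD, i.e. of $\{\mathbf{x}\in\mathbb{R}^{nd}: \mathbf{x}=\mathbf{W}\mathbf{x}-\alpha\nabla F(\mathbf{x})\}$. (b) If $\{\mathbf{x}^k\}$ is generated by the asynchronous DGD-ATC (from an arbitrary initial point $\mathbf{x}^0\in\mathbb{R}^{nd}$) with step-size $$\alpha\in\Big(0,\,\frac{2}{\max_{i\in\mathcal{V}}L_i}\Big),$$ then $\{\mathbf{x}^k\}$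 converges to some element of the fixed point set of the synchronous DGD-ATC, i.e. of $\{\mathbf{x}\in\mathbb{R}^{nd}: \mathbf{x}=\mathbf{W}(\mathbf{x}-\alpha\nabla F(\mathbf{x}))\}$.
   Context: Network: $\mathcal{G}=(\mathcal{V},\mathcal{E})$ is an undirected, connected graph with vertex set $\mathcal{V}=\{1,\dots,n\}$; $\mathcal{N}_i=\{j:\{i,j\}\in\mathcal{E}\}$ and $\bar{\mathcal{N}}_i=\mathcal{N}_i\cup\{i\}$. $\mathbb{N}_0$ denotes the natural numbers including $0$. A matrix $W=(w_{ij})\in\mathbb{R}^{n\times n}$ is an averaging matrix associated with $\mathcal{G}$ if it is entrywise non-negative, symmetric ($W=W^T$), stochastic ($W\mathbf{1}=\mathbf{1}$, with $\mathbf{1}$ the all-one vector), and satisfies $w_{ij}=0$ if and only if $\{i,j\}\notin\mathcal{E}$ and $i\neq j$. Put $\mathbf{W}=W\otimes I_d$ (Kronecker product). For $\mathbf{x}=(x_1^T,\dots,x_n^T)^T\in\mathbb{R}^{nd}$ with $x_i\in\mathbb{R}^d$, $F(\mathbf{x})=\sum_{i\in\mathcal{V}}f_i(x_i)$. With $\|\cdot\|$ the $\ell_2$ norm, a differentiable $g:\mathbb{R}^d\to\mathbb{R}$ is $L$-smooth if $\|\nabla g(y)-\nabla g(x)\|\le L\|y-x\|$ for all $x,y\in\mathbb{R}^d$, and $\mu$-strongly convex if $\langle\nabla g(y)-\nabla g(x),y-x\rangle\ge\mu\|y-x\|^2$ for all $x,y\in\mathbb{R}^d$. Synchronous algorithms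 with step-size $\alpha>0$: DGD is $\mathbf{x}^{k+1}=\mathbf{W}\mathbf{x}^k-\alpha\nabla F(\mathbf{x}^k)$; DGD-ATC is $\mathbf{x}^{k+1}=\mathbf{W}(\mathbf{x}^k-\alpha\nabla F(\mathbf{x}^k))$. Asynchronous algorithms: for each $i\in\mathcal{V}$, $\mathcal{K}_i\subseteq\mathbb{N}_0$ is the set of iterations at which node $i$ updates; for $i\in\mathcal{V}$, $j\in\mathcal{N}_i$, $k\in\mathbb{N}_0$, $s_{ij}^k\in[0,k]$ is an integer (the iteration index of the most recent version of $x_j$ available to node $i$ at iteration $k$), and $s_{ii}^k=k$. The asynchronous DGD generates $\mathbf{x}^k=((x_1^k)^T,\dots,(x_n^k)^T)^T$ by, for each $i\in\mathcal{V}$ and $k\in\mathbb{N}_0$, $$x_i^{k+1}=\begin{cases}\sum_{j\in\bar{\mathcal{N}}_i}w_{ij}x_j^{s_{ij}^k}-\alpha\nabla f_i(x_i^k),&k\in\mathcal{K}_i,\\ x_i^k,&\text{otherwise.}\end{cases}$$ The asynchronous DGD-ATC generates $\mathbf{x}^k$ by, for each $i\in\mathcal{V}$ and $k\in\mathbb{N}_0$, $$x_i^{k+1}=\begin{cases}\sum_{j\in\bar{\mathcal{N}}_i}w_{ij}\big(x_j^{s_{ij}^k}-\alpha\nabla f_j(x_j^{s_{ij}^k})\big),&k\in\mathcal{K}_i,\\ x_i^k,&\text{otherwise.}\end{cases}$$ *)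

theory Defs
  imports "HOL-Analysis.Analysis"
begin

section \<open>Graphs and averaging matrices\<close>

text \<open>The vertex set is the whole finite type \<open>'n\<close>; an undirected simple graph is given by its
  set of edges, each edge being a two-element set of vertices.\<close>

definition simple_graph :: "'n set set \<Rightarrow> bool" where
  "simple_graph E \<longleftrightarrow> (\<forall>e\<in>E. card e = 2)"

definition connected_graph :: "'n set set \<Rightarrow> bool" where
  "connected_graph E \<longleftrightarrow> (\<forall>u v. (u, v) \<in> {(a, b). {a, b} \<in> E}\<^sup>*)"

definition neighbours :: "'n set set \<Rightarrow> 'n \<Rightarrow> 'n set" where
  "neighbours E i = {j. {i, j} \<in> E}"

text \<open>In the last clause, taking \<open>i = j\<close> forces nonzero (hence positive) diagonal entries.\<close>

definition averaging_matrix :: "'n::finite set set \<Rightarrow> real^'n^'n \<Rightarrow> bool" where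
  "averaging_matrix E W \<longleftrightarrow>
     (\<forall>i j. 0 \<le> W $ i $ j) \<and>
     W = transpose W \<and>
     W *v 1 = 1 \<and>
     (\<forall>i j. W $ i $ j = 0 \<longleftrightarrow> {i, j} \<notin> E \<and> i \<noteq> j)"

section \<open>Stacked vectors\<close>

text \<open>A vector of dimension $nd$ is indexed by pairs (node, coordinate).\<close>

definition block :: "real^('n::finite \<times> 'd::finite) \<Rightarrow> 'n \<Rightarrow> real^'d" where
  "block x i = (\<chi> l. x $ (i, l))"

definition kronecker ::
  "real^'b::finite^'a::finite \<Rightarrow> real^'d::finite^'c::finite \<Rightarrow> real^('b \<times> 'd)^('a \<times> 'c)" where
  "kronecker A B = (\<chi> p q. A $ fst p $ fst q * B $ snd p $ snd q)"

section \<open>Functions\<close>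

text \<open>The value is meaningful only where the function is differentiable.\<close>

definition grad :: "('a::real_inner \<Rightarrow> real) \<Rightarrow> 'a \<Rightarrow> 'a" where
  "grad g x = (THE D. GDERIV g x :> D)"

definition proper_fun :: "('a \<Rightarrow> ereal) \<Rightarrow> bool" where
  "proper_fun g \<longleftrightarrow> (\<exists>x. g x < \<infinity>) \<and> (\<forall>x. - \<infinity> < g x)"

definition closed_fun :: "('a::topological_space \<Rightarrow> real) \<Rightarrow> bool" where
  "closed_fun g \<longleftrightarrow> closed (epigraph UNIV g)"

definition smooth_fun :: "real \<Rightarrow> ('a::real_inner \<Rightarrow> real) \<Rightarrow> bool" where
  "smooth_fun L g \<longleftrightarrow>
     (\<forall>x. g differentiable at x) \<and>
     (\<forall>x y. norm (grad g y - grad g x) \<le> L * norm (y - x))"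

definition strongly_convex_fun :: "real \<Rightarrow> ('a::real_inner \<Rightarrow> real) \<Rightarrow> bool" where
  "strongly_convex_fun \<mu> g \<longleftrightarrow>
     (\<forall>x. g differentiable at x) \<and>
     (\<forall>x y. inner (grad g y - grad g x) (y - x) \<ge> \<mu> * (norm (y - x))\<^sup>2)"

definition minimizers :: "('a \<Rightarrow> real) \<Rightarrow> 'a set" where
  "minimizers g = {x. is_arg_min g (\<lambda>_. True) x}"

definition stacked_objective ::
  "('n::finite \<Rightarrow> real^'d::finite \<Rightarrow> real) \<Rightarrow> real^('n \<times> 'd) \<Rightarrow> real" where
  "stacked_objective f x = (\<Sum>i\<in>UNIV. f i (block x i))"

section \<open>Synchronous algorithms\<close>

definition dgd_step ::
  "real^'n::finite^'n \<Rightarrow> ('n \<Rightarrow> real^'d::finite \<Rightarrow> real) \<Rightarrow> real \<Rightarrow>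
   real^('n \<times> 'd) \<Rightarrow> real^('n \<times> 'd)" where
  "dgd_step W f \<alpha> x =
     kronecker W (mat 1 :: real^'d^'d) *v x - \<alpha> *\<^sub>R grad (stacked_objective f) x"

definition dgd_atc_step ::
  "real^'n::finite^'n \<Rightarrow> ('n \<Rightarrow> real^'d::finite \<Rightarrow> real) \<Rightarrow> real \<Rightarrow>
   real^('n \<times> 'd) \<Rightarrow> real^('n \<times> 'd)" where
  "dgd_atc_step W f \<alpha> x =
     kronecker W (mat 1 :: real^'d^'d) *v (x - \<alpha> *\<^sub>R grad (stacked_objective f) x)"

definition fixed_points :: "('a \<Rightarrow> 'a) \<Rightarrow> 'a set" where
  "fixed_points T = {x. x = T x}"

section \<open>Asynchronous algorithms\<close>

text \<open>\<open>s i j k\<close> is the iteration index of the version of block \<open>j\<close> that node \<open>i\<close> holds at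
  iteration \<open>k\<close>; its values for \<open>j\<close> outside the closed neighbourhood of \<open>i\<close> are irrelevant.\<close>

definition delay_indices :: "'n set set \<Rightarrow> ('n \<Rightarrow> 'n \<Rightarrow> nat \<Rightarrow> nat) \<Rightarrow> bool" where
  "delay_indices E s \<longleftrightarrow>
     (\<forall>i. \<forall>j\<in>neighbours E i. \<forall>k. s i j k \<le> k) \<and> (\<forall>i k. s i i k = k)"

definition total_asynchrony ::
  "'n set set \<Rightarrow> ('n \<Rightarrow> nat set) \<Rightarrow> ('n \<Rightarrow> 'n \<Rightarrow> nat \<Rightarrow> nat) \<Rightarrow> bool" where
  "total_asynchrony E K s \<longleftrightarrow>
     (\<forall>i. infinite (K i)) \<and>
     (\<forall>i. \<forall>j\<in>neighbours E i. filterlim (s i j) at_top sequentially)"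

definition async_dgd ::
  "'n::finite set set \<Rightarrow> real^'n^'n \<Rightarrow> ('n \<Rightarrow> real^'d::finite \<Rightarrow> real) \<Rightarrow> real \<Rightarrow>
   ('n \<Rightarrow> nat set) \<Rightarrow> ('n \<Rightarrow> 'n \<Rightarrow> nat \<Rightarrow> nat) \<Rightarrow> (nat \<Rightarrow> real^('n \<times> 'd)) \<Rightarrow> bool" where
  "async_dgd E W f \<alpha> K s x \<longleftrightarrow>
     (\<forall>i k. block (x (Suc k)) i =
        (if k \<in> K i
         then (\<Sum>j\<in>neighbours E i \<union> {i}. W $ i $ j *\<^sub>R block (x (s i j k)) j)
              - \<alpha> *\<^sub>R grad (f i) (block (x k) i)
         else block (x k) i))"

definition async_dgd_atc ::
  "'n::finite set set \<Rightarrow> real^'n^'n \<Rightarrow> ('n \<Rightarrow> real^'d::finite \<Rightarrow> real) \<Rightarrow> real \<Rightarrow>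
   ('n \<Rightarrow> nat set) \<Rightarrow> ('n \<Rightarrow> 'n \<Rightarrow> nat \<Rightarrow> nat) \<Rightarrow> (nat \<Rightarrow> real^('n \<times> 'd)) \<Rightarrow> bool" where
  "async_dgd_atc E W f \<alpha> K s x \<longleftrightarrow>
     (\<forall>i k. block (x (Suc k)) i =
        (if k \<in> K i
         then (\<Sum>j\<in>neighbours E i \<union> {i}. W $ i $ j *\<^sub>R
                 (block (x (s i j k)) j - \<alpha> *\<^sub>R grad (f j) (block (x (s i j k)) j)))
         else block (x k) i))"

end

theory Submission
  imports Defs
begin

text \<open>
  Both synchronous maps are contractions in the block maximum norm
  \<open>\<bar>v\<bar> = max\<^sub>i \<parallel>v\<^sub>i\<parallel>\<close>, and this norm is the one that tolerates arbitrary delays.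

  The source of the contraction is the local gradient step. For a gradient that is
  \<open>L\<close>-Lipschitz and monotone, the Baillon--Haddad inequality
  \<open>\<parallel>\<nabla>g y - \<nabla>g x\<parallel>\<^sup>2 \<le> L \<langle>\<nabla>g y - \<nabla>g x, y - x\<rangle>\<close> holds (\<open>gradient_cocoercive\<close>); expanding the
  square and using strong convexity, \<open>y \<mapsto> y - \<beta> \<nabla>g y\<close> is a contraction for every
  \<open>0 < \<beta> < 2 / L\<close> (\<open>gradient_step_contraction\<close>). A DGD-ATC update is a weighted average of such
  steps with \<open>\<beta> = \<alpha>\<close>. A DGD update at node \<open>i\<close> is a weighted average of the neighbours' values and
  of the single gradient step \<open>x\<^sub>i - (\<alpha> / w\<^sub>i\<^sub>i) \<nabla>f\<^sub>i x\<^sub>i\<close>, the latter with the positive weight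
  \<open>w\<^sub>i\<^sub>i\<close>; this is where the bound \<open>\<alpha> < 2 w\<^sub>i\<^sub>i / L\<^sub>i\<close> comes from, and one contracting summand
  of positive weight suffices.

  For a contraction with factor \<open>q\<close> in the block maximum norm there is a fixed point
  (\<open>max_norm_contraction_fixed_point\<close>). Under total asynchrony, if all block errors are
  eventually at most \<open>B\<close>, then all information in use is eventually that accurate, and after one
  more update of every node all block errors are at most \<open>q B\<close>. Iterating, the errors vanish
  (\<open>asynchronous_errors_vanish\<close>).
\<close>

section \<open>Gradients\<close>

lemma GDERIV_grad:
  fixes g :: "'a::euclidean_space \<Rightarrow> real"
  assumes "g differentiable at x"
  shows "GDERIV g x :> grad g x"
proof -
  obtain D where D: "(g has_derivative D) (at x)"
    using assms by (auto simp: differentiable_def)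
  interpret bounded_linear D
    using D by (rule has_derivative_bounded_linear)
  define v where "v = (\<Sum>b\<in>Basis. D b *\<^sub>R b)"
  have "D h = inner h v" for h
  proof -
    have "D h = D (\<Sum>b\<in>Basis. inner h b *\<^sub>R b)"
      by (simp add: euclidean_representation)
    also have "\<dots> = inner h v"
      by (simp add: sum scaleR v_def inner_sum_right mult.commute)
    finally show ?thesis .
  qed
  then have "D = (\<lambda>h. inner h v)" by blast
  with D have v: "GDERIV g x :> v"
    by (simp add: gderiv_def)
  have unique: "w = v" if "GDERIV g x :> w" for w
  proof -
    have "(\<lambda>h. inner h w) = (\<lambda>h. inner h v)"
      using that v unfolding gderiv_def by (rule has_derivative_unique)
    then have "inner (w - v) w = inner (w - v) v" by metis
    then have "inner (w - v) (w - v) = 0" by (simp add: inner_diff_right)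
    then show ?thesis by simp
  qed
  show ?thesis
    unfolding grad_def using v unique by (rule theI)
qed

lemma grad_eqI:
  fixes g :: "'a::euclidean_space \<Rightarrow> real"
  assumes "GDERIV g x :> v"
  shows "grad g x = v"
proof -
  have "g differentiable at x"
    using assms by (auto simp: gderiv_def differentiable_def)
  then have "GDERIV g x :> grad g x" by (rule GDERIV_grad)
  then have "(\<lambda>h. inner h (grad g x)) = (\<lambda>h. inner h v)"
    using assms unfolding gderiv_def by (rule has_derivative_unique)
  then have "inner (grad g x - v) (grad g x) = inner (grad g x - v) v" by metis
  then have "inner (grad g x - v) (grad g x - v) = 0" by (simp add: inner_diff_right)
  then show ?thesis by simp
qed

lemma DERIV_along_line:
  fixes g :: "'a::euclidean_space \<Rightarrow> real"
  assumes "\<And>x. g differentiable at x"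
  shows "((\<lambda>t. g (x + t *\<^sub>R h)) has_real_derivative inner (grad g (x + t *\<^sub>R h)) h) (at t)"
proof -
  have "((\<lambda>t. g (x + t *\<^sub>R h)) has_derivative (\<lambda>r. inner (r *\<^sub>R h) (grad g (x + t *\<^sub>R h)))) (at t)"
    using GDERIV_grad[OF assms, of "x + t *\<^sub>R h"] unfolding gderiv_def
    by (intro has_derivative_compose[where f = "\<lambda>t. x + t *\<^sub>R h" and g = g])
      (auto intro!: derivative_eq_intros)
  also have "(\<lambda>r. inner (r *\<^sub>R h) (grad g (x + t *\<^sub>R h))) = (*) (inner (grad g (x + t *\<^sub>R h)) h)"
    by (simp add: fun_eq_iff inner_commute[of h])
  finally show ?thesis
    by (simp add: has_field_derivative_def)
qed

section \<open>Contraction of the gradient step\<close>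

text \<open>The descent lemma: along the segment from \<open>x\<close> to \<open>y\<close>, the slope of \<open>g\<close> exceeds the slope at
  \<open>x\<close> by at most \<open>L t \<parallel>y - x\<parallel>\<^sup>2\<close>, so subtracting the claimed
  bound leaves a function \<open>\<phi>\<close> that decreases in \<open>t\<close>.\<close>

lemma smooth_quadratic_upper_bound:
  fixes g :: "'a::euclidean_space \<Rightarrow> real"
  assumes "smooth_fun L g"
  shows "g y \<le> g x + inner (grad g x) (y - x) + L / 2 * (norm (y - x))\<^sup>2"
proof -
  define h where "h = y - x"
  define \<phi> where "\<phi> t = g (x + t *\<^sub>R h) - t * inner (grad g x) h - L / 2 * t\<^sup>2 * (norm h)\<^sup>2" for t
  define \<phi>' where "\<phi>' t = inner (grad g (x + t *\<^sub>R h)) h - inner (grad g x) h - L * t * (norm h)\<^sup>2" for t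
  have diff: "\<And>x. g differentiable at x"
    using assms by (simp add: smooth_fun_def)
  have deriv: "(\<phi> has_real_derivative \<phi>' t) (at t)" for t
    unfolding \<phi>_def \<phi>'_def
    by (rule derivative_eq_intros DERIV_along_line[OF diff] refl)+ (simp add: field_simps)
  have "\<phi>' t \<le> 0" if "0 \<le> t" for t
  proof -
    have "norm (grad g (x + t *\<^sub>R h) - grad g x) \<le> L * norm (x + t *\<^sub>R h - x)"
      using assms unfolding smooth_fun_def by blast
    then have lip: "norm (grad g (x + t *\<^sub>R h) - grad g x) \<le> L * (t * norm h)"
      using that by simp
    have "inner (grad g (x + t *\<^sub>R h) - grad g x) h \<le> norm (grad g (x + t *\<^sub>R h) - grad g x) * norm h"
      by (rule norm_cauchy_schwarz)
    also have "\<dots> \<le> (L * (t * norm h)) * norm h"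
      using lip by (rule mult_right_mono) simp
    finally show ?thesis
      by (simp add: \<phi>'_def inner_diff_left power2_eq_square algebra_simps)
  qed
  then have "\<phi> 1 \<le> \<phi> 0"
    using deriv by (intro DERIV_nonpos_imp_nonincreasing[of 0 1 \<phi>]) auto
  then show ?thesis
    by (simp add: \<phi>_def h_def)
qed

lemma monotone_gradient_tangent_below:
  fixes g :: "'a::euclidean_space \<Rightarrow> real"
  assumes diff: "\<And>x. g differentiable at x"
    and mono: "\<And>x y. 0 \<le> inner (grad g y - grad g x) (y - x)"
  shows "g x + inner (grad g x) (y - x) \<le> g y"
proof -
  define h where "h = y - x"
  define \<phi> where "\<phi> t = g (x + t *\<^sub>R h) - t * inner (grad g x) h" for t
  define \<phi>' where "\<phi>' t = inner (grad g (x + t *\<^sub>R h)) h - inner (grad g x) h" for t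
  have deriv: "(\<phi> has_real_derivative \<phi>' t) (at t)" for t
    unfolding \<phi>_def \<phi>'_def
    by (rule derivative_eq_intros DERIV_along_line[OF diff] refl)+ simp
  have "0 \<le> \<phi>' t" if "0 \<le> t" for t
  proof (cases "t = 0")
    case False
    have "0 \<le> t * inner (grad g (x + t *\<^sub>R h) - grad g x) h"
      using mono[of "x + t *\<^sub>R h" x] by simp
    then show ?thesis
      using that False by (simp add: \<phi>'_def inner_diff_left zero_le_mult_iff)
  qed (simp add: \<phi>'_def)
  then have "\<phi> 0 \<le> \<phi> 1"
    using deriv by (intro DERIV_nonneg_imp_nondecreasing[of 0 1 \<phi>]) auto
  then show ?thesis
    by (simp add: \<phi>_def h_def)
qed

text \<open>The Baillon--Haddad inequality. The tangent of \<open>g\<close> at \<open>x\<close> and the descent parabola at \<open>y\<close>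
  enclose \<open>g z\<close>; minimizing their difference over \<open>z\<close> improves the tangent inequality
  by \<open>\<parallel>\<nabla>g y - \<nabla>g x\<parallel>\<^sup>2 / (2 L)\<close>, and the claim is the sum of that bound and its mirror image.\<close>

lemma gradient_cocoercive:
  fixes g :: "'a::euclidean_space \<Rightarrow> real"
  assumes smooth: "smooth_fun L g" and "0 < L"
    and mono: "\<And>x y. 0 \<le> inner (grad g y - grad g x) (y - x)"
  shows "(norm (grad g y - grad g x))\<^sup>2 \<le> L * inner (grad g y - grad g x) (y - x)"
proof -
  have diff: "\<And>x. g differentiable at x"
    using smooth by (simp add: smooth_fun_def)
  have half: "g x + inner (grad g x) (y - x) + (norm (grad g y - grad g x))\<^sup>2 / (2 * L) \<le> g y" for x y
  proof -
    define v where "v = grad g y - grad g x"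
    \<comment> \<open>the minimizer of the parabola at \<open>y\<close> minus the tangent at \<open>x\<close>\<close>
    define z where "z = y - (1 / L) *\<^sub>R v"
    have "g x + inner (grad g x) (z - x) \<le> g z"
      using diff mono by (rule monotone_gradient_tangent_below)
    also have "g z \<le> g y + inner (grad g y) (z - y) + L / 2 * (norm (z - y))\<^sup>2"
      using smooth by (rule smooth_quadratic_upper_bound)
    finally have "g x + inner (grad g x) (y - x) - inner (grad g x) v / L
        \<le> g y - inner (grad g y) v / L + L / 2 * ((norm v)\<^sup>2 / L\<^sup>2)"
      by (simp add: z_def inner_diff_right power_divide)
    moreover have "L / 2 * ((norm v)\<^sup>2 / L\<^sup>2) = (norm v)\<^sup>2 / (2 * L)"
      using \<open>0 < L\<close> by (simp add: power2_eq_square)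
    moreover have "inner (grad g y) v / L - inner (grad g x) v / L = (norm v)\<^sup>2 / L"
      by (simp add: power2_norm_eq_inner diff_divide_distrib[symmetric] inner_diff_left[symmetric]
          v_def[symmetric])
    moreover have "(norm v)\<^sup>2 / L = (norm v)\<^sup>2 / (2 * L) + (norm v)\<^sup>2 / (2 * L)"
      by simp
    ultimately show ?thesis
      unfolding v_def by linarith
  qed
  have "(norm (grad g y - grad g x))\<^sup>2 / (2 * L) + (norm (grad g x - grad g y))\<^sup>2 / (2 * L)
      \<le> - inner (grad g x) (y - x) - inner (grad g y) (x - y)"
    using half[of x y] half[of y x] by linarith
  also have "\<dots> = inner (grad g y - grad g x) (y - x)"
    by (simp add: inner_diff_left inner_diff_right)
  finally have "(norm (grad g y - grad g x))\<^sup>2 / L \<le> inner (grad g y - grad g x) (y - x)"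
    by (simp add: norm_minus_commute)
  then show ?thesis
    using \<open>0 < L\<close> by (simp add: divide_le_eq mult.commute)
qed

text \<open>With \<open>v = y - x\<close> and \<open>w = \<nabla>g y - \<nabla>g x\<close>, cocoercivity absorbs the quadratic term:
  \<open>\<parallel>v - \<beta> w\<parallel>\<^sup>2 \<le> \<parallel>v\<parallel>\<^sup>2 - \<beta> (2 - \<beta> L) \<langle>w, v\<rangle>\<close>, and strong convexity bounds the last inner
  product below.\<close>

lemma gradient_step_contraction:
  fixes g :: "'a::euclidean_space \<Rightarrow> real"
  assumes smooth: "smooth_fun L g" and "0 < L"
    and strong: "strongly_convex_fun \<mu> g" and "0 < \<mu>"
    and "0 < \<beta>" and "\<beta> < 2 / L"
  obtains q where "0 \<le> q" "q < 1"
    "\<And>x y. norm ((y - \<beta> *\<^sub>R grad g y) - (x - \<beta> *\<^sub>R grad g x)) \<le> q * norm (y - x)"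
proof
  define c where "c = \<beta> * (2 - \<beta> * L)"
  define q where "q = sqrt (max 0 (1 - c * \<mu>))"
  have "0 < c"
    using assms by (simp add: c_def less_divide_eq)
  then show "0 \<le> q" "q < 1"
    using \<open>0 < \<mu>\<close> by (auto simp: q_def)
  fix x y :: 'a
  define v where "v = y - x"
  define w where "w = grad g y - grad g x"
  have strong': "\<mu> * (norm (y - x))\<^sup>2 \<le> inner (grad g y - grad g x) (y - x)" for x y
    using strong unfolding strongly_convex_fun_def by blast
  have mono: "0 \<le> inner (grad g y - grad g x) (y - x)" for x y
    using strong'[where x = x and y = y] \<open>0 < \<mu>\<close>
    by (meson order_trans mult_nonneg_nonneg less_imp_le zero_le_power2)
  have coco: "(norm w)\<^sup>2 \<le> L * inner w v"
    unfolding w_def v_def using smooth \<open>0 < L\<close> mono by (rule gradient_cocoercive)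
  have "(norm (v - \<beta> *\<^sub>R w))\<^sup>2 = (norm v)\<^sup>2 - 2 * \<beta> * inner w v + \<beta>\<^sup>2 * (norm w)\<^sup>2"
    unfolding power2_norm_eq_inner power2_eq_square[of \<beta>]
    by (simp add: inner_diff_left inner_diff_right inner_commute algebra_simps)
  also have "\<dots> \<le> (norm v)\<^sup>2 - 2 * \<beta> * inner w v + \<beta>\<^sup>2 * (L * inner w v)"
    using coco by (simp add: mult_left_mono)
  also have "\<dots> = (norm v)\<^sup>2 - c * inner w v"
    by (simp add: c_def power2_eq_square algebra_simps)
  also have "\<dots> \<le> (norm v)\<^sup>2 - c * (\<mu> * (norm v)\<^sup>2)"
    using strong'[where x = x and y = y] \<open>0 < c\<close> by (simp add: v_def w_def mult_left_mono)
  also have "\<dots> = (1 - c * \<mu>) * (norm v)\<^sup>2"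
    by (simp add: algebra_simps)
  also have "\<dots> \<le> max 0 (1 - c * \<mu>) * (norm v)\<^sup>2"
    by (rule mult_right_mono) auto
  also have "\<dots> = (q * norm v)\<^sup>2"
    by (simp add: q_def power_mult_distrib)
  finally have "norm (v - \<beta> *\<^sub>R w) \<le> q * norm v"
    by (rule power2_le_imp_le) (simp add: q_def)
  then show "norm ((y - \<beta> *\<^sub>R grad g y) - (x - \<beta> *\<^sub>R grad g x)) \<le> q * norm (y - x)"
    by (simp add: v_def w_def scaleR_diff_right algebra_simps)
qed

section \<open>Asynchronous iteration of a maximum-norm contraction\<close>

text \<open>Bounds pass from level \<open>B\<close> to level \<open>q B\<close>: once every error is at most \<open>B\<close> and
  every piece of information in use dates from after that time, each update of block \<open>i\<close> brings
  its error to at most \<open>q B\<close>, and neither later updates nor idling undo this. The bound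
  \<open>s i j k \<le> k\<close> on the version index gives the uniform bound that starts the descent.\<close>

lemma asynchronous_errors_vanish:
  fixes e :: "nat \<Rightarrow> 'n::finite \<Rightarrow> real"
  assumes nonneg: "\<And>k i. 0 \<le> e k i"
    and past: "\<And>i j k. j \<in> N i \<Longrightarrow> s i j k \<le> k"
    and fresh: "\<And>i j. j \<in> N i \<Longrightarrow> filterlim (s i j) at_top sequentially"
    and updates: "\<And>i. infinite (K i)"
    and q: "0 \<le> q" "q < 1"
    and update: "\<And>i k M. k \<in> K i \<Longrightarrow> (\<And>j. j \<in> N i \<Longrightarrow> e (s i j k) j \<le> M) \<Longrightarrow> e (Suc k) i \<le> q * M"
    and idle: "\<And>i k. k \<notin> K i \<Longrightarrow> e (Suc k) i \<le> e k i"
  shows "(\<lambda>k. e k i) \<longlonglongrightarrow> 0"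
proof -
  define C where "C = (\<Sum>i\<in>UNIV. e 0 i)"
  have "0 \<le> C"
    by (simp add: C_def sum_nonneg nonneg)
  have bounded: "\<forall>i. e k i \<le> C" for k
  proof (induction k rule: less_induct)
    case (less k)
    show ?case
    proof (cases k)
      case 0
      then show ?thesis
        by (auto simp: C_def nonneg intro: member_le_sum)
    next
      case (Suc m)
      have "e (Suc m) i \<le> C" for i
      proof (cases "m \<in> K i")
        case True
        then have "e (Suc m) i \<le> q * C"
          using less past Suc by (intro update) (auto simp: le_imp_less_Suc)
        also have "\<dots> \<le> C"
          using q \<open>0 \<le> C\<close> by (simp add: mult_left_le_one_le)
        finally show ?thesis .
      next
        case False
        then have "e (Suc m) i \<le> e m i" by (rule idle)
        also have "\<dots> \<le> C" using less[of m] Suc by simp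
        finally show ?thesis .
      qed
      then show ?thesis using Suc by simp
    qed
  qed
  have descend: "\<forall>\<^sub>F k in sequentially. \<forall>i. e k i \<le> q * B"
    if B: "\<forall>\<^sub>F k in sequentially. \<forall>i. e k i \<le> B" for B
  proof -
    obtain k0 where k0: "\<And>k i. k0 \<le> k \<Longrightarrow> e k i \<le> B"
      using B by (auto simp: eventually_sequentially)
    have "\<forall>\<^sub>F k in sequentially. e k i \<le> q * B" for i
    proof -
      have "\<forall>\<^sub>F k in sequentially. \<forall>j\<in>N i. k0 \<le> s i j k"
        using fresh by (intro eventually_ball_finite) (auto simp: filterlim_at_top)
      then obtain k1 where k1: "\<And>k j. k1 \<le> k \<Longrightarrow> j \<in> N i \<Longrightarrow> k0 \<le> s i j k"
        by (auto simp: eventually_sequentially)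
      have improved: "e (Suc k) i \<le> q * B" if "k1 \<le> k" "k \<in> K i" for k
        using that k0 k1 by (intro update) auto
      obtain k2 where k2: "k1 \<le> k2" "k2 \<in> K i"
        using updates[of i] by (meson infinite_nat_iff_unbounded_le)
      have "e k i \<le> q * B" if "Suc k2 \<le> k" for k
        using that
      proof (induction k rule: dec_induct)
        case base
        show ?case using improved k2 by blast
      next
        case (step k)
        then show ?case
          using improved[of k] idle[of k i] k2 by (cases "k \<in> K i") auto
      qed
      then show ?thesis
        by (auto simp: eventually_sequentially)
    qed
    then show ?thesis
      by (simp add: eventually_all_finite)
  qed
  have levels: "\<forall>\<^sub>F k in sequentially. \<forall>i. e k i \<le> q ^ m * C" for m
  proof (induction m)
    case 0
    then show ?case using bounded by simp
  next
    case (Suc m)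
    then show ?case using descend by (simp add: mult.assoc)
  qed
  have "(\<lambda>m. q ^ m * C) \<longlonglongrightarrow> 0"
    using q by (intro tendsto_mult_left_zero LIMSEQ_realpow_zero) auto
  show ?thesis
  proof (rule tendstoI)
    fix \<epsilon> :: real assume "0 < \<epsilon>"
    then have "\<forall>\<^sub>F m in sequentially. q ^ m * C < \<epsilon>"
      using \<open>(\<lambda>m. q ^ m * C) \<longlonglongrightarrow> 0\<close> by (simp add: order_tendsto_iff)
    then obtain m where "q ^ m * C < \<epsilon>"
      by (auto simp: eventually_sequentially)
    show "\<forall>\<^sub>F k in sequentially. dist (e k i) 0 < \<epsilon>"
      using levels[of m]
    proof eventually_elim
      case (elim k)
      then have "e k i < \<epsilon>"
        using \<open>q ^ m * C < \<epsilon>\<close> by (blast intro: le_less_trans)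
      then show ?case
        by (simp add: dist_real_def nonneg)
    qed
  qed
qed

text \<open>The Picard iterates are Cauchy in every block, because their increments shrink
  geometrically in the maximum norm.\<close>

lemma max_norm_contraction_fixed_point:
  fixes T :: "'n::finite \<Rightarrow> ('n \<Rightarrow> 'a::banach) \<Rightarrow> 'a"
  assumes q: "0 \<le> q" "q < 1"
    and contr: "\<And>i u v M. (\<And>j. norm (u j - v j) \<le> M) \<Longrightarrow> norm (T i u - T i v) \<le> q * M"
  shows "\<exists>z. \<forall>i. T i z = z i"
proof -
  define y where "y k = ((\<lambda>v i. T i v) ^^ k) (\<lambda>_. 0)" for k
  have y_Suc: "y (Suc k) i = T i (y k)" for k i
    by (simp add: y_def)
  define C where "C = (\<Sum>j\<in>UNIV. norm (y 1 j - y 0 j))"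
  have increment: "norm (y (Suc k) i - y k i) \<le> q ^ k * C" for k i
  proof (induction k arbitrary: i)
    case 0
    have "norm (y 1 i - y 0 i) \<le> C"
      unfolding C_def by (rule member_le_sum) auto
    then show ?case by simp
  next
    case (Suc k)
    then have "norm (T i (y (Suc k)) - T i (y k)) \<le> q * (q ^ k * C)"
      by (rule contr)
    then show ?case by (simp add: y_Suc mult.assoc)
  qed
  have "convergent (\<lambda>k. y k i)" for i
  proof -
    have "summable (\<lambda>k. q ^ k * C)"
      using q by (intro summable_mult2 summable_geometric) simp
    then have "summable (\<lambda>k. y (Suc k) i - y k i)"
      by (rule summable_comparison_test') (rule increment)
    then have "convergent (\<lambda>n. \<Sum>k<n. y (Suc k) i - y k i)"
      by (simp add: summable_iff_convergent)
    then have "convergent (\<lambda>n. y n i - y 0 i + y 0 i)"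
      by (intro convergent_add convergent_const) (simp add: sum_lessThan_telescope[of "\<lambda>k. y k i"])
    then show ?thesis by simp
  qed
  then obtain z where z: "\<And>i. (\<lambda>k. y k i) \<longlonglongrightarrow> z i"
    unfolding convergent_def by metis
  have "T i z = z i" for i
  proof (rule LIMSEQ_unique)
    show "(\<lambda>k. y (Suc k) i) \<longlonglongrightarrow> z i"
      using z by (rule LIMSEQ_Suc)
    have bound: "norm (T i (y k) - T i z) \<le> q * (\<Sum>j\<in>UNIV. norm (y k j - z j))" for k
      by (rule contr, rule member_le_sum) auto
    have "(\<lambda>k. q * (\<Sum>j\<in>UNIV. norm (y k j - z j))) \<longlonglongrightarrow> q * (\<Sum>j\<in>(UNIV :: 'n set). 0)"
      by (intro tendsto_intros) (auto simp: tendsto_norm_zero_iff intro: LIM_zero z)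
    then have "(\<lambda>k. q * (\<Sum>j\<in>UNIV. norm (y k j - z j))) \<longlonglongrightarrow> 0"
      by simp
    with always_eventually have "(\<lambda>k. T i (y k) - T i z) \<longlonglongrightarrow> 0"
      by (rule Lim_null_comparison) (use bound in blast)
    then show "(\<lambda>k. y (Suc k) i) \<longlonglongrightarrow> T i z"
      by (simp add: y_Suc LIM_zero_iff)
  qed
  then show ?thesis by blast
qed

lemma asynchronous_contraction_converges:
  fixes T :: "'n::finite \<Rightarrow> ('n \<Rightarrow> 'a::banach) \<Rightarrow> 'a" and x :: "nat \<Rightarrow> 'n \<Rightarrow> 'a"
  assumes past: "\<And>i j k. j \<in> N i \<Longrightarrow> s i j k \<le> k"
    and fresh: "\<And>i j. j \<in> N i \<Longrightarrow> filterlim (s i j) at_top sequentially"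
    and updates: "\<And>i. infinite (K i)"
    and q: "0 \<le> q" "q < 1"
    and contr: "\<And>i u v M. (\<And>j. j \<in> N i \<Longrightarrow> norm (u j - v j) \<le> M) \<Longrightarrow> norm (T i u - T i v) \<le> q * M"
    and iter: "\<And>i k. x (Suc k) i = (if k \<in> K i then T i (\<lambda>j. x (s i j k) j) else x k i)"
  shows "\<exists>z. \<forall>i. T i z = z i \<and> (\<lambda>k. x k i) \<longlonglongrightarrow> z i"
proof -
  have "norm (T i u - T i v) \<le> q * M" if "\<And>j. norm (u j - v j) \<le> M" for i u v M
    using that by (rule contr)
  with q obtain z where z: "\<And>i. T i z = z i"
    using max_norm_contraction_fixed_point[of q T] by blast
  have "(\<lambda>k. norm (x k i - z i)) \<longlonglongrightarrow> 0" for i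
    using _ past fresh updates q
  proof (rule asynchronous_errors_vanish)
    fix i k M assume "k \<in> K i" "\<And>j. j \<in> N i \<Longrightarrow> norm (x (s i j k) j - z j) \<le> M"
    then show "norm (x (Suc k) i - z i) \<le> q * M"
      using contr[of i "\<lambda>j. x (s i j k) j" z M] by (simp add: iter z)
  qed (auto simp: iter)
  then have "(\<lambda>k. x k i) \<longlonglongrightarrow> z i" for i
    by (simp add: tendsto_norm_zero_iff LIM_zero_iff)
  with z show ?thesis by blast
qed

section \<open>Stacked vectors\<close>

lemma block_eqI:
  assumes "\<And>i. block x i = block y i"
  shows "x = y"
proof -
  have "x $ p = y $ p" for p
    using arg_cong[OF assms[of "fst p"], of "\<lambda>v. v $ snd p"] by (simp add: block_def)
  then show ?thesis by (simp add: vec_eq_iff)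
qed

lemma tendsto_of_blocks:
  assumes "\<And>i. (\<lambda>k. block (x k) i) \<longlonglongrightarrow> block y i"
  shows "x \<longlonglongrightarrow> y"
proof (rule vec_tendstoI)
  fix p
  have "(\<lambda>k. block (x k) (fst p) $ snd p) \<longlonglongrightarrow> block y (fst p) $ snd p"
    by (intro tendsto_vec_nth assms)
  then show "(\<lambda>k. x k $ p) \<longlonglongrightarrow> y $ p"
    by (simp add: block_def)
qed

lemma block_kronecker_mat_1:
  "block (kronecker W (mat 1) *v x) i = (\<Sum>j\<in>UNIV. W $ i $ j *\<^sub>R block x j)"
proof -
  have "(\<Sum>p\<in>UNIV. W $ i $ fst p * mat 1 $ l $ snd p * x $ p) = (\<Sum>j\<in>UNIV. W $ i $ j * x $ (j, l))" for l
  proof -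
    have "(\<Sum>p\<in>UNIV. W $ i $ fst p * mat 1 $ l $ snd p * x $ p)
        = (\<Sum>j\<in>UNIV. \<Sum>m\<in>UNIV. W $ i $ j * mat 1 $ l $ m * x $ (j, m))"
      by (simp add: sum.cartesian_product case_prod_beta flip: UNIV_Times_UNIV)
    also have "\<dots> = (\<Sum>j\<in>UNIV. \<Sum>m\<in>UNIV. if m = l then W $ i $ j * x $ (j, m) else 0)"
      by (intro sum.cong) (auto simp: mat_def)
    finally show ?thesis by simp
  qed
  then show ?thesis
    by (simp add: vec_eq_iff block_def kronecker_def matrix_vector_mult_def)
qed

lemma block_grad_stacked_objective:
  fixes f :: "'n::finite \<Rightarrow> real^'d::finite \<Rightarrow> real"
  assumes diff: "\<And>i x. f i differentiable at x"
  shows "block (grad (stacked_objective f) x) i = grad (f i) (block x i)"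
proof -
  define D :: "real^('n \<times> 'd)" where "D = (\<chi> p. grad (f (fst p)) (block x (fst p)) $ snd p)"
  have linear: "bounded_linear (\<lambda>x :: real^('n \<times> 'd). block x i)" for i
    by (intro linear_conv_bounded_linear[THEN iffD1] linearI) (auto simp: block_def vec_eq_iff)
  have "((\<lambda>x. f i (block x i)) has_derivative (\<lambda>h. inner (block h i) (grad (f i) (block x i)))) (at x)" for i
    using GDERIV_grad[OF diff, of i "block x i"] unfolding gderiv_def
    by (intro has_derivative_compose[where f = "\<lambda>x. block x i" and g = "f i"]
        bounded_linear_imp_has_derivative linear)
  then have "(stacked_objective f has_derivative
      (\<lambda>h. \<Sum>i\<in>UNIV. inner (block h i) (grad (f i) (block x i)))) (at x)"
    unfolding stacked_objective_def by (intro has_derivative_sum) auto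
  also have "(\<lambda>h. \<Sum>i\<in>UNIV. inner (block h i) (grad (f i) (block x i))) = (\<lambda>h. inner h D)"
    by (simp add: inner_vec_def D_def block_def sum.cartesian_product case_prod_beta
        flip: UNIV_Times_UNIV)
  finally have "grad (stacked_objective f) x = D"
    by (intro grad_eqI) (simp add: gderiv_def)
  then show ?thesis
    by (simp add: D_def block_def vec_eq_iff)
qed

lemma neighbour_weights:
  fixes v :: "'n::finite \<Rightarrow> 'a::real_vector"
  assumes "averaging_matrix E W"
  shows "0 \<le> W $ i $ j" "0 < W $ i $ i" "(\<Sum>j\<in>neighbours E i \<union> {i}. W $ i $ j) = 1"
    and "(\<Sum>j\<in>UNIV. W $ i $ j *\<^sub>R v j) = (\<Sum>j\<in>neighbours E i \<union> {i}. W $ i $ j *\<^sub>R v j)"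
proof -
  show nonneg: "0 \<le> W $ i $ j" for i j
    using assms by (simp add: averaging_matrix_def)
  have zero: "W $ i $ j = 0 \<longleftrightarrow> {i, j} \<notin> E \<and> i \<noteq> j" for i j
    using assms by (simp add: averaging_matrix_def)
  show "0 < W $ i $ i"
    using nonneg[of i i] zero[of i i] by (simp add: less_le)
  have "(W *v 1) $ i = 1"
    using assms by (simp add: averaging_matrix_def)
  then have "(\<Sum>j\<in>UNIV. W $ i $ j) = 1"
    by (simp add: matrix_vector_mult_def)
  moreover have "(\<Sum>j\<in>UNIV. W $ i $ j) = (\<Sum>j\<in>neighbours E i \<union> {i}. W $ i $ j)"
    by (rule sum.mono_neutral_right) (auto simp: zero neighbours_def)
  ultimately show "(\<Sum>j\<in>neighbours E i \<union> {i}. W $ i $ j) = 1" by simp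
  show "(\<Sum>j\<in>UNIV. W $ i $ j *\<^sub>R v j) = (\<Sum>j\<in>neighbours E i \<union> {i}. W $ i $ j *\<^sub>R v j)"
    by (rule sum.mono_neutral_right) (auto simp: zero neighbours_def)
qed

text \<open>A block iteration driven by a maximum-norm contraction turns into a statement on stacked
  vectors: the fixed point is reassembled from its blocks. The factors \<open>q i\<close> may differ between
  nodes, since there are finitely many of them.\<close>

lemma asynchronous_stacked_iteration_converges:
  fixes T :: "'n::finite \<Rightarrow> ('n \<Rightarrow> real^'d::finite) \<Rightarrow> real^'d"
    and S :: "real^('n \<times> 'd) \<Rightarrow> real^('n \<times> 'd)"
  assumes delays: "delay_indices E s" and asynchrony: "total_asynchrony E K s"
    and q: "\<And>i. 0 \<le> q i" "\<And>i. q i < 1"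
    and contr: "\<And>i u v M. (\<And>j. j \<in> neighbours E i \<union> {i} \<Longrightarrow> norm (u j - v j) \<le> M) \<Longrightarrow>
      norm (T i u - T i v) \<le> q i * M"
    and iter: "\<And>i k. block (x (Suc k)) i =
      (if k \<in> K i then T i (\<lambda>j. block (x (s i j k)) j) else block (x k) i)"
    and S: "\<And>i x. block (S x) i = T i (block x)"
  shows "\<exists>y\<in>fixed_points S. x \<longlonglongrightarrow> y"
proof -
  define r where "r = Max (range q)"
  have q_le: "q i \<le> r" for i by (simp add: r_def)
  have "0 \<le> r"
    using q(1) q_le by (rule order_trans)
  moreover have "r < 1"
    by (simp add: r_def q(2))
  ultimately have r: "0 \<le> r" "r < 1" .
  have self: "s i i = (\<lambda>k. k)" for i
    using delays by (auto simp: delay_indices_def)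
  have past: "s i j k \<le> k" if "j \<in> neighbours E i \<union> {i}" for i j k
    using that delays by (auto simp: delay_indices_def)
  have fresh: "filterlim (s i j) at_top sequentially" if "j \<in> neighbours E i \<union> {i}" for i j
    using that asynchrony by (auto simp: total_asynchrony_def self filterlim_ident)
  have updates: "infinite (K i)" for i
    using asynchrony by (simp add: total_asynchrony_def)
  have contr': "norm (T i u - T i v) \<le> r * M"
    if "\<And>j. j \<in> neighbours E i \<union> {i} \<Longrightarrow> norm (u j - v j) \<le> M" for i u v M
  proof -
    have "0 \<le> M"
      using that[of i] norm_ge_zero[of "u i - v i"] by (simp del: norm_ge_zero)
    then have "q i * M \<le> r * M"
      using q_le by (simp add: mult_right_mono)
    with contr[of i u v M] that show ?thesis by simp
  qed
  have "\<exists>z. \<forall>i. T i z = z i \<and> (\<lambda>k. block (x k) i) \<longlonglongrightarrow> z i"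
    using past fresh updates r contr' iter
    by (rule asynchronous_contraction_converges)
  then obtain z where z: "\<And>i. T i z = z i" "\<And>i. (\<lambda>k. block (x k) i) \<longlonglongrightarrow> z i"
    by blast
  define y :: "real^('n \<times> 'd)" where "y = (\<chi> p. z (fst p) $ snd p)"
  have y: "block y = z"
    by (auto simp: block_def y_def vec_eq_iff)
  have "y = S y"
    by (rule block_eqI) (simp add: S y z)
  moreover have "x \<longlonglongrightarrow> y"
    by (rule tendsto_of_blocks) (simp add: y z)
  ultimately show ?thesis
    by (auto simp: fixed_points_def)
qed

section \<open>Convergence of the two algorithms\<close>

text \<open>The gradient term is merged with the node's own value, which has weight \<open>W $ i $ i\<close>; hence the
  effective step-size \<open>\<alpha> / W $ i $ i\<close>.\<close>

lemma dgd_update_contraction: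
  fixes W :: "real^'n::finite^'n" and g :: "'a::euclidean_space \<Rightarrow> real"
  assumes "simple_graph E" and averaging: "averaging_matrix E W"
    and "0 < L" "smooth_fun L g" "0 < \<mu>" "strongly_convex_fun \<mu> g"
    and "0 < \<alpha>" and \<alpha>: "\<alpha> < 2 * (W $ i $ i / L)"
  obtains q where "0 \<le> q" "q < 1"
    "\<And>u v M. (\<And>j. j \<in> neighbours E i \<union> {i} \<Longrightarrow> norm (u j - v j) \<le> M) \<Longrightarrow>
      norm (((\<Sum>j\<in>neighbours E i \<union> {i}. W $ i $ j *\<^sub>R u j) - \<alpha> *\<^sub>R grad g (u i))
          - ((\<Sum>j\<in>neighbours E i \<union> {i}. W $ i $ j *\<^sub>R v j) - \<alpha> *\<^sub>R grad g (v i))) \<le> q * M"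
proof -
  define w where "w = W $ i $ i"
  have "0 < w"
    unfolding w_def using averaging by (rule neighbour_weights)
  have "{i} \<notin> E"
    using \<open>simple_graph E\<close> by (force simp: simple_graph_def)
  then have "i \<notin> neighbours E i"
    by (simp add: neighbours_def)
  then have split: "(\<Sum>j\<in>neighbours E i \<union> {i}. h j) = h i + (\<Sum>j\<in>neighbours E i. h j)"
    for h :: "'n \<Rightarrow> 'c::comm_monoid_add"
    by simp
  define c where "c = (\<Sum>j\<in>neighbours E i. W $ i $ j)"
  have c: "w + c = 1"
    unfolding c_def w_def split[symmetric] using averaging by (rule neighbour_weights)
  have "0 \<le> c"
    unfolding c_def using averaging by (intro sum_nonneg neighbour_weights(1))
  have "0 < \<alpha> / w" "\<alpha> / w < 2 / L"
    using \<open>0 < \<alpha>\<close> \<open>0 < w\<close> \<open>0 < L\<close> \<alpha> by (auto simp: w_def field_simps)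
  then obtain q where q: "0 \<le> q" "q < 1"
    "\<And>x y. norm ((y - (\<alpha> / w) *\<^sub>R grad g y) - (x - (\<alpha> / w) *\<^sub>R grad g x)) \<le> q * norm (y - x)"
    using gradient_step_contraction assms by metis
  show thesis
  proof (rule that)
    show "0 \<le> w * q + c"
      using q \<open>0 < w\<close> \<open>0 \<le> c\<close> by simp
    show "w * q + c < 1"
    proof -
      have "w * q < w * 1"
        using q(2) \<open>0 < w\<close> by (rule mult_strict_left_mono)
      with c show ?thesis by simp
    qed
    fix u v :: "'n \<Rightarrow> 'a" and M
    assume M: "\<And>j. j \<in> neighbours E i \<union> {i} \<Longrightarrow> norm (u j - v j) \<le> M"
    define step where "step y = y - (\<alpha> / w) *\<^sub>R grad g y" for y
    have step: "w *\<^sub>R step y = w *\<^sub>R y - \<alpha> *\<^sub>R grad g y" for y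
      using \<open>0 < w\<close> by (simp add: step_def scaleR_diff_right)
    have "norm (step (u i) - step (v i)) \<le> q * norm (u i - v i)"
      unfolding step_def by (rule q)
    also have "\<dots> \<le> q * M"
      using q M by (simp add: mult_left_mono)
    finally have own: "norm (w *\<^sub>R (step (u i) - step (v i))) \<le> w * (q * M)"
      using \<open>0 < w\<close> by simp
    have others: "norm (\<Sum>j\<in>neighbours E i. W $ i $ j *\<^sub>R (u j - v j)) \<le> c * M"
      unfolding c_def sum_distrib_right using M neighbour_weights(1)[OF averaging]
      by (intro sum_norm_le) (simp add: mult_left_mono)
    have regroup: "((\<Sum>j\<in>neighbours E i \<union> {i}. W $ i $ j *\<^sub>R u j) - \<alpha> *\<^sub>R grad g (u i))
        - ((\<Sum>j\<in>neighbours E i \<union> {i}. W $ i $ j *\<^sub>R v j) - \<alpha> *\<^sub>R grad g (v i))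
      = w *\<^sub>R (step (u i) - step (v i)) + (\<Sum>j\<in>neighbours E i. W $ i $ j *\<^sub>R (u j - v j))"
      unfolding split scaleR_diff_right sum_subtractf step by (simp add: w_def)
    show "norm (((\<Sum>j\<in>neighbours E i \<union> {i}. W $ i $ j *\<^sub>R u j) - \<alpha> *\<^sub>R grad g (u i))
          - ((\<Sum>j\<in>neighbours E i \<union> {i}. W $ i $ j *\<^sub>R v j) - \<alpha> *\<^sub>R grad g (v i))) \<le> (w * q + c) * M"
      unfolding regroup using norm_triangle_mono[OF own others] by (simp add: distrib_right mult.assoc)
  qed
qed

lemma neighbour_average_contraction:
  fixes W :: "real^'n::finite^'n" and G :: "'n \<Rightarrow> 'a::real_normed_vector \<Rightarrow> 'a"
  assumes averaging: "averaging_matrix E W"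
    and "0 \<le> q" and G: "\<And>j x y. norm (G j y - G j x) \<le> q * norm (y - x)"
    and M: "\<And>j. j \<in> neighbours E i \<union> {i} \<Longrightarrow> norm (u j - v j) \<le> M"
  shows "norm ((\<Sum>j\<in>neighbours E i \<union> {i}. W $ i $ j *\<^sub>R G j (u j))
             - (\<Sum>j\<in>neighbours E i \<union> {i}. W $ i $ j *\<^sub>R G j (v j))) \<le> q * M"
proof -
  have "norm (W $ i $ j *\<^sub>R (G j (u j) - G j (v j))) \<le> W $ i $ j * (q * M)"
    if "j \<in> neighbours E i \<union> {i}" for j
  proof -
    have "norm (G j (u j) - G j (v j)) \<le> q * norm (u j - v j)" by (rule G)
    also have "\<dots> \<le> q * M"
      using M[OF that] \<open>0 \<le> q\<close> by (rule mult_left_mono)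
    finally show ?thesis
      using neighbour_weights(1)[OF averaging] by (simp add: mult_left_mono)
  qed
  then have "norm (\<Sum>j\<in>neighbours E i \<union> {i}. W $ i $ j *\<^sub>R (G j (u j) - G j (v j)))
      \<le> (\<Sum>j\<in>neighbours E i \<union> {i}. W $ i $ j * (q * M))"
    by (rule sum_norm_le)
  also have "\<dots> = q * M"
    unfolding sum_distrib_right[symmetric] neighbour_weights(3)[OF averaging] by simp
  finally show ?thesis
    by (simp only: scaleR_diff_right sum_subtractf)
qed

theorem theorem1:
  fixes E :: "'n::finite set set"
    and W :: "real^'n^'n"
    and f :: "'n \<Rightarrow> real^'d::finite \<Rightarrow> real"
    and L \<mu> :: "'n \<Rightarrow> real"
    and K :: "'n \<Rightarrow> nat set"
    and s :: "'n \<Rightarrow> 'n \<Rightarrow> nat \<Rightarrow> nat"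
  assumes graph: "simple_graph E" "connected_graph E"
    and averaging: "averaging_matrix E W"
    and proper: "\<And>i. proper_fun (\<lambda>x. ereal (f i x))"
    and closed: "\<And>i. closed_fun (f i)"
    and convex: "\<And>i. convex_on UNIV (f i)"
    and lower_bounded: "\<And>i. bdd_below (range (f i))"
    and L_pos: "\<And>i. 0 < L i"
    and smooth: "\<And>i. smooth_fun (L i) (f i)"
    and mu_pos: "\<And>i. 0 < \<mu> i"
    and strongly_convex: "\<And>i. strongly_convex_fun (\<mu> i) (f i)"
    and solutions: "minimizers (\<lambda>x. \<Sum>i\<in>UNIV. f i x) \<noteq> {}"
      "bounded (minimizers (\<lambda>x. \<Sum>i\<in>UNIV. f i x))"
    and delays: "delay_indices E s"
    and asynchrony: "total_asynchrony E K s"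
  shows "(\<forall>(\<alpha>::real) (x :: nat \<Rightarrow> real^('n \<times> 'd)).
            \<alpha> \<in> {0 <..< 2 * Min (range (\<lambda>i. W $ i $ i / L i))} \<longrightarrow>
            async_dgd E W f \<alpha> K s x \<longrightarrow>
            (\<exists>y \<in> fixed_points (dgd_step W f \<alpha>). x \<longlonglongrightarrow> y)) \<and>
         (\<forall>(\<alpha>::real) (x :: nat \<Rightarrow> real^('n \<times> 'd)).
            \<alpha> \<in> {0 <..< 2 / Max (range L)} \<longrightarrow>
            async_dgd_atc E W f \<alpha> K s x \<longrightarrow>
            (\<exists>y \<in> fixed_points (dgd_atc_step W f \<alpha>). x \<longlonglongrightarrow> y))"
proof (intro conjI allI impI)
  have diff: "f i differentiable at y" for i y
    using smooth[of i] by (simp add: smooth_fun_def)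
  note block_grad = block_grad_stacked_objective[of f, OF diff]
  have block_diff: "block (u - c *\<^sub>R v) i = block u i - c *\<^sub>R block v i"
    for u v :: "real^('n \<times> 'd)" and c i
    by (simp add: block_def vec_eq_iff)
  note block_mix = block_kronecker_mat_1 neighbour_weights(4)[OF averaging]
  {
    fix \<alpha> :: real and x :: "nat \<Rightarrow> real^('n \<times> 'd)"
    assume \<alpha>: "\<alpha> \<in> {0 <..< 2 * Min (range (\<lambda>i. W $ i $ i / L i))}"
      and async: "async_dgd E W f \<alpha> K s x"
    have \<alpha>_less: "\<alpha> < 2 * (W $ i $ i / L i)" for i
    proof -
      have "Min (range (\<lambda>i. W $ i $ i / L i)) \<le> W $ i $ i / L i"
        by (rule Min_le) auto
      moreover have "\<alpha> < 2 * Min (range (\<lambda>i. W $ i $ i / L i))"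
        using \<alpha> by (simp only: greaterThanLessThan_iff)
      ultimately show ?thesis by linarith
    qed
    define T where "T i v = (\<Sum>j\<in>neighbours E i \<union> {i}. W $ i $ j *\<^sub>R v j) - \<alpha> *\<^sub>R grad (f i) (v i)"
      for i and v :: "'n \<Rightarrow> real^'d"
    have "\<exists>q. 0 \<le> q \<and> q < 1 \<and> (\<forall>u v M. (\<forall>j \<in> neighbours E i \<union> {i}. norm (u j - v j) \<le> M) \<longrightarrow>
        norm (T i u - T i v) \<le> q * M)" for i
    proof -
      have "0 < \<alpha>" using \<alpha> by simp
      obtain q where "0 \<le> q" "q < 1"
        "\<And>u v M. (\<And>j. j \<in> neighbours E i \<union> {i} \<Longrightarrow> norm (u j - v j) \<le> M) \<Longrightarrow>
          norm (T i u - T i v) \<le> q * M"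
        unfolding T_def
        using dgd_update_contraction[OF graph(1) averaging L_pos smooth mu_pos strongly_convex
            \<open>0 < \<alpha>\<close> \<alpha>_less]
        by blast
      then show ?thesis by blast
    qed
    then obtain q where q: "\<And>i. 0 \<le> q i" "\<And>i. q i < 1"
      "\<And>i u v M. (\<forall>j \<in> neighbours E i \<union> {i}. norm (u j - v j) \<le> M) \<Longrightarrow>
        norm (T i u - T i v) \<le> q i * M"
      by metis
    show "\<exists>y \<in> fixed_points (dgd_step W f \<alpha>). x \<longlonglongrightarrow> y"
    proof (rule asynchronous_stacked_iteration_converges[OF delays asynchrony q(1,2)])
      show "block (x (Suc k)) i =
          (if k \<in> K i then T i (\<lambda>j. block (x (s i j k)) j) else block (x k) i)" for i k
        using async delays by (simp add: async_dgd_def T_def delay_indices_def)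
      show "block (dgd_step W f \<alpha> y) i = T i (block y)" for i y
        by (simp only: dgd_step_def T_def block_diff block_mix block_grad)
    qed (use q(3) in blast)
  next
    fix \<alpha> :: real and x :: "nat \<Rightarrow> real^('n \<times> 'd)"
    assume \<alpha>: "\<alpha> \<in> {0 <..< 2 / Max (range L)}"
      and async: "async_dgd_atc E W f \<alpha> K s x"
    have \<alpha>_less: "\<alpha> < 2 / L i" for i
    proof -
      have "L i \<le> Max (range L)" by simp
      then have "2 / Max (range L) \<le> 2 / L i"
        using L_pos[of i] by (intro divide_left_mono mult_pos_pos) linarith+
      with \<alpha> show ?thesis by simp
    qed
    define G where "G j y = y - \<alpha> *\<^sub>R grad (f j) y" for j y
    have "\<exists>q. 0 \<le> q \<and> q < 1 \<and> (\<forall>y z. norm (G j y - G j z) \<le> q * norm (y - z))" for j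
    proof -
      have "0 < \<alpha>" using \<alpha> by simp
      then show ?thesis
        unfolding G_def
        using gradient_step_contraction[OF smooth L_pos strongly_convex mu_pos _ \<alpha>_less]
        by metis
    qed
    then obtain q where q: "\<And>j. 0 \<le> q j" "\<And>j. q j < 1"
      "\<And>j y z. norm (G j y - G j z) \<le> q j * norm (y - z)"
      by metis
    define r where "r = Max (range q)"
    have q_le: "q j \<le> r" for j by (simp add: r_def)
    have "0 \<le> r"
      using q(1) q_le by (rule order_trans)
    moreover have "r < 1"
      by (simp add: r_def q(2))
    ultimately have r: "0 \<le> r" "r < 1" .
    have G: "norm (G j y - G j z) \<le> r * norm (y - z)" for j y z
      using q(3) q_le by (meson mult_right_mono norm_ge_zero order_trans)
    define T where "T i v = (\<Sum>j\<in>neighbours E i \<union> {i}. W $ i $ j *\<^sub>R G j (v j))"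
      for i and v :: "'n \<Rightarrow> real^'d"
    show "\<exists>y \<in> fixed_points (dgd_atc_step W f \<alpha>). x \<longlonglongrightarrow> y"
    proof (rule asynchronous_stacked_iteration_converges[OF delays asynchrony, where q = "\<lambda>_. r"])
      show "norm (T i u - T i v) \<le> r * M"
        if "\<And>j. j \<in> neighbours E i \<union> {i} \<Longrightarrow> norm (u j - v j) \<le> M" for i u v M
        unfolding T_def using averaging r(1) G that by (rule neighbour_average_contraction)
      show "block (x (Suc k)) i =
          (if k \<in> K i then T i (\<lambda>j. block (x (s i j k)) j) else block (x k) i)" for i k
        using async by (simp add: async_dgd_atc_def T_def G_def)
      show "block (dgd_atc_step W f \<alpha> y) i = T i (block y)" for i y
        by (simp only: dgd_atc_step_def T_def G_def block_diff block_mix block_grad)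
    qed (use r in auto)
  }
qed

end
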